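(* The real projective space $\mathbf{RP}^3=\{[x_1:x_2:x_3:x_4]:x_i\in\mathbf{R}\}\subset\mathbf{CP}^3$ is a special Lagrangian submanifold of the nearly Kähler $\mathbf{CP}^3$ (with the $SU(3)$-structure $(\Omega,\Psi)$ on $\mathbf{CP}^3$ defined in the context).
   Context: Let $\mathbf{H}$ be the quaternions, written $q=z+jw$ with $z,w\in\mathbf{C}$, $j^2=-1$, $zj=j\bar z$. Identify $\mathbf{C}^4=\mathbf{H}^2$ by $(z_1,z_2,z_3,z_4)\sim(z_1+jz_2,\,z_3+jz_4)$, with $\mathbf{C}$ and $\mathbf{H}$ acting on the right, and put $\langle(q_1,q_2),(p_1,p_2)\rangle=\overline{q_1}p_1+\overline{q_2}p_2$. Let $\mathfrak{F}$ be the space of pairs $(e_1,e_2)$, $e_i\in\mathbf{H}^2$, with $\langle e_1,e_1\rangle=\langle e_2,e_2\rangle=1$, $\langle e_1,e_2\rangle=0$ (a copy of $Sp(2)$), and $\mathtt{j}:\mathfrak{F}\to\mathbf{CP}^3$, $(e_1,e_2)\mapsto e_1\mathbf{C}$. Define quaternion-valued $1$-forms $\phi^a_b$ on $\mathfrak{F}$ by $de_a=\sum_be_b\phi^b_a$; they satisfy $\phi^a_b+\overline{\phi^b_a}=0$. Define real forms $\rho_1,\rho_2$ and complex forms $\omega_1,\omega_2,\omega_3,\tau$ by $$\begin{pmatrix}\phi^1_1&\phi^1_2\\ \phi^2_1&\phi^2_2\end{pmatrix}=\begin{pmatrix}i\rho_1+j\overline{\omega_3}&-\frac{\overline{\omega_1}}{\sqrt2}+j\frac{\omega_2}{\sqrt2}\\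 \frac{\omega_1}{\sqrt2}+j\frac{\omega_2}{\sqrt2}&i\rho_2+j\tau\end{pmatrix}.$$ The nearly Kähler structure on $\mathbf{CP}^3$ (whose almost complex structure is not the standard one) is the $SU(3)$-structure with $$\mathtt{j}^*\Omega=\tfrac{\sqrt{-1}}2\sum_{i=1}^3\omega_i\wedge\overline{\omega_i},\qquad\mathtt{j}^*\Psi=\omega_1\wedge\omega_2\wedge\omega_3,$$ and metric whose pullback is $\sum_i\omega_i\circ\overline{\omega_i}$. A $3$-dimensional submanifold $L$ is special Lagrangian if, for one of its orientations, $\mathrm{Re}\,\Psi$ restricts to the volume form of $L$; for orientable $L$ this is equivalent to $\Omega|_L=\mathrm{Im}\,\Psi|_L=0$. *)

theory Defs
  imports "HOL-Analysis.Analysis"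
begin

section \<open>Embedded submanifolds of a normed space\<close>

text \<open>Iterated directional derivatives; meaningful on open subsets of finite-dimensional spaces.\<close>

primrec Ck_on :: "nat \<Rightarrow> 'a::real_normed_vector set \<Rightarrow> ('a \<Rightarrow> 'b::real_normed_vector) \<Rightarrow> bool" where
  "Ck_on 0 S f \<longleftrightarrow> continuous_on S f"
| "Ck_on (Suc n) S f \<longleftrightarrow>
     (\<forall>x\<in>S. f differentiable (at x)) \<and> (\<forall>v. Ck_on n S (\<lambda>x. frechet_derivative f (at x) v))"

definition smooth_on :: "'a::real_normed_vector set \<Rightarrow> ('a \<Rightarrow> 'b::real_normed_vector) \<Rightarrow> bool" where
  "smooth_on S f \<longleftrightarrow> (\<forall>n. Ck_on n S f)"

definition local_parametrization ::
  "(real^'k \<Rightarrow> 'a::real_normed_vector) \<Rightarrow> (real^'k) set \<Rightarrow> 'a set \<Rightarrow> bool" where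
  "local_parametrization \<psi> W S \<longleftrightarrow>
     open W \<and> smooth_on W \<psi> \<and> (\<forall>x\<in>W. inj (frechet_derivative \<psi> (at x))) \<and>
     openin (top_of_set S) (\<psi> ` W) \<and> (\<exists>\<theta>. homeomorphism W (\<psi> ` W) \<psi> \<theta>)"

text \<open>The dimension of the submanifold is the cardinality of the index type \<open>'k\<close>. A subset of an
  embedded submanifold \<open>M\<close> is an embedded submanifold of \<open>M\<close> iff it is one of the ambient space.\<close>

definition smooth_submanifold :: "'k::finite itself \<Rightarrow> 'a::real_normed_vector set \<Rightarrow> bool" where
  "smooth_submanifold (_ :: 'k itself) S \<longleftrightarrow>
     (\<forall>p\<in>S. \<exists>(\<psi> :: real^'k \<Rightarrow> 'a) W. local_parametrization \<psi> W S \<and> p \<in> \<psi> ` W)"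

text \<open>Velocities at \<open>p\<close> of curves in \<open>S\<close>. At a point of a submanifold, curves that are merely
  differentiable at time 0 have the same velocities as smooth ones.\<close>

definition tangent_space :: "'a::real_normed_vector set \<Rightarrow> 'a \<Rightarrow> 'a set" where
  "tangent_space S p =
     {v. \<exists>\<gamma>. range \<gamma> \<subseteq> S \<and> \<gamma> 0 = p \<and> (\<gamma> has_vector_derivative v) (at (0::real))}"

definition tangent_frames :: "'a::real_normed_vector set \<Rightarrow> 'a \<Rightarrow> ('a^'k) set" where
  "tangent_frames S p =
     {b. inj (\<lambda>i. b $ i) \<and> independent (range (\<lambda>i. b $ i)) \<and>
         span (range (\<lambda>i. b $ i)) = tangent_space S p}"

definition same_orientation :: "'a::real_normed_vector^'k \<Rightarrow> 'a^'k \<Rightarrow> bool" where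
  "same_orientation b b' \<longleftrightarrow>
     (\<exists>A :: real^'k^'k. det A > 0 \<and> (\<forall>i. b' $ i = (\<Sum>j\<in>UNIV. A $ i $ j *\<^sub>R b $ j)))"

text \<open>\<open>ori p\<close> is the set of positively oriented bases of the tangent space at \<open>p\<close>; the second
  conjunct says that the choice is continuous in \<open>p\<close>.\<close>

definition orientation :: "'a::real_normed_vector set \<Rightarrow> ('a \<Rightarrow> ('a^'k) set) \<Rightarrow> bool" where
  "orientation S ori \<longleftrightarrow>
     (\<forall>p\<in>S. (\<exists>b\<in>tangent_frames S p. ori p = {b'. same_orientation b b'}) \<and>
            (\<exists>U s. openin (top_of_set S) U \<and> p \<in> U \<and> continuous_on U s \<and> (\<forall>q\<in>U. s q \<in> ori q)))"

text \<open>The Riemannian volume form: \<open>\<plusminus>sqrt (det (g (v\<^sub>i, v\<^sub>j)))\<close>, with sign + iff \<open>v\<close> is positively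
  oriented. On linearly dependent tuples the root vanishes.\<close>

definition volume_form ::
  "('a \<Rightarrow> 'a \<Rightarrow> 'a \<Rightarrow> real) \<Rightarrow> ('a \<Rightarrow> ('a^'k) set) \<Rightarrow> 'a \<Rightarrow> 'a^'k \<Rightarrow> real" where
  "volume_form g ori p v =
     (if v \<in> ori p then 1 else -1) * sqrt (det (\<chi> i j. g p (v $ i) (v $ j)))"

section \<open>Special Lagrangian submanifolds\<close>

text \<open>A \<open>k\<close>-form assigns a number to a point and a \<open>k\<close>-tuple of tangent vectors there; its values on
  other arguments are irrelevant.\<close>

record 'a su3_structure =
  space_of :: "'a set"
  Omega_of :: "'a \<Rightarrow> 'a^2 \<Rightarrow> real"
  Psi_of :: "'a \<Rightarrow> 'a^3 \<Rightarrow> complex"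
  metric_of :: "'a \<Rightarrow> 'a \<Rightarrow> 'a \<Rightarrow> real"

definition special_lagrangian :: "'a::real_normed_vector su3_structure \<Rightarrow> 'a set \<Rightarrow> bool" where
  "special_lagrangian N L \<longleftrightarrow>
     L \<subseteq> space_of N \<and> smooth_submanifold TYPE(3) L \<and>
     (\<exists>ori. orientation L ori \<and>
        (\<forall>p\<in>L. \<forall>v :: 'a^3. (\<forall>i. v $ i \<in> tangent_space L p) \<longrightarrow>
           Re (Psi_of N p v) = volume_form (metric_of N) ori p v))"

section \<open>Quaternions\<close>

text \<open>The pair \<open>(z, w)\<close> stands for \<open>z + j w\<close>, where \<open>j\<^sup>2 = -1\<close> and \<open>z j = j (cnj z)\<close>.\<close>

type_synonym quat = "complex \<times> complex"

definition qmult :: "quat \<Rightarrow> quat \<Rightarrow> quat" (infixl "\<star>" 70) where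
  "p \<star> q = (fst p * fst q - cnj (snd p) * snd q, cnj (fst p) * snd q + snd p * fst q)"

definition qcnj :: "quat \<Rightarrow> quat" where
  "qcnj q = (cnj (fst q), - snd q)"

lemma qmult_relations:
  shows "(0, 1) \<star> (0, 1) = (-1, 0)"
    and "(z, 0) \<star> (0, 1) = (0, 1) \<star> (cnj z, 0)"
    and "(z, w) = (z, 0) + (0, 1) \<star> (w, 0)"
    and "(a, 0) \<star> (b, 0) = (a * b, 0)"
    and "(p \<star> q) \<star> r = p \<star> (q \<star> r)"
    and "(p + q) \<star> r = p \<star> r + q \<star> r" and "p \<star> (q + r) = p \<star> q + p \<star> r"
    and "(1, 0) \<star> q = q" and "q \<star> (1, 0) = q"
    and "qcnj (p \<star> q) = qcnj q \<star> qcnj p"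
  by (simp_all add: qmult_def qcnj_def algebra_simps prod_eq_iff)

definition qvec_scale :: "quat^2 \<Rightarrow> quat \<Rightarrow> quat^2" (infixl "\<star>\<^sub>v" 70) where
  "v \<star>\<^sub>v q = (\<chi> i. v $ i \<star> q)"

definition qinner :: "quat^2 \<Rightarrow> quat^2 \<Rightarrow> quat" where
  "qinner v w = qcnj (v $ 1) \<star> w $ 1 + qcnj (v $ 2) \<star> w $ 2"

definition quat2_to_complex4 :: "quat^2 \<Rightarrow> complex^4" where
  "quat2_to_complex4 v = vector [fst (v $ 1), snd (v $ 1), fst (v $ 2), snd (v $ 2)]"

section \<open>Complex projective space\<close>

text \<open>A complex line in \<open>\<complex>\<^sup>4\<close> is represented by the matrix \<open>z z\<^sup>* / |z|\<^sup>2\<close> of the orthogonal projection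
  onto it. This is the standard embedding of \<open>\<complex>P\<^sup>3\<close> as a smooth submanifold of the space of
  complex \<open>4 \<times> 4\<close> matrices; \<open>hpoint z\<close> is the point with homogeneous coordinates \<open>z\<close>.\<close>

definition hpoint :: "complex^4 \<Rightarrow> complex^4^4" where
  "hpoint z = (\<chi> i k. z $ i * cnj (z $ k) / of_real ((norm z)\<^sup>2))"

lemma hpoint_eq_iff:
  assumes "z \<noteq> 0" "w \<noteq> 0"
  shows "hpoint z = hpoint w \<longleftrightarrow> (\<exists>c. c \<noteq> 0 \<and> z = c *s w)"
proof
  assume eq: "hpoint z = hpoint w"
  have act: "hpoint y *v x = ((\<Sum>k\<in>UNIV. cnj (y $ k) * x $ k) / of_real ((norm y)\<^sup>2)) *s y" for x y
    by (simp add: hpoint_def matrix_vector_mult_def vec_eq_iff sum_distrib_left sum_divide_distrib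
        mult_ac)
  have nrm: "(\<Sum>k\<in>UNIV. cnj (y $ k) * y $ k) = of_real ((norm y)\<^sup>2)" for y :: "complex^4"
    by (simp add: norm_vec_def L2_set_def sum_nonneg complex_norm_square mult.commute
        del: of_real_power)
  have "z = hpoint z *v z"
    using assms by (simp add: act nrm)
  then have "z = ((\<Sum>k\<in>UNIV. cnj (w $ k) * z $ k) / of_real ((norm w)\<^sup>2)) *s w"
    unfolding eq act .
  then show "\<exists>c. c \<noteq> 0 \<and> z = c *s w"
    using assms(1) by (metis vector_smult_lzero)
next
  assume "\<exists>c. c \<noteq> 0 \<and> z = c *s w"
  then obtain c where c: "c \<noteq> 0" "z = c *s w" by blast
  have "norm z = cmod c * norm w"
    by (simp add: c(2) norm_vec_def norm_mult L2_set_right_distrib)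
  then have n: "complex_of_real ((norm z)\<^sup>2) = c * cnj c * of_real ((norm w)\<^sup>2)"
    by (simp add: power_mult_distrib complex_norm_square del: of_real_power)
  have "z $ i * cnj (z $ k) = c * cnj c * (w $ i * cnj (w $ k))" for i k
    by (simp add: c(2))
  then show "hpoint z = hpoint w"
    using c(1) by (simp add: hpoint_def vec_eq_iff n del: of_real_power)
qed

definition CP3 :: "(complex^4^4) set" where
  "CP3 = {hpoint z | z. z \<noteq> 0}"

definition RP3 :: "(complex^4^4) set" where
  "RP3 = {hpoint (\<chi> i. complex_of_real (x $ i)) | x :: real^4. x \<noteq> 0}"

section \<open>The frame bundle and the nearly Kaehler structure\<close>

text \<open>For \<open>f :: quat^2^2\<close> the vector \<open>e\<^sub>a\<close> is \<open>f $ a\<close>.\<close>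

definition frames :: "(quat^2^2) set" where
  "frames = {f. qinner (f $ 1) (f $ 1) = (1, 0) \<and> qinner (f $ 2) (f $ 2) = (1, 0) \<and>
                qinner (f $ 1) (f $ 2) = 0}"

definition frame_proj :: "quat^2^2 \<Rightarrow> complex^4^4" where
  "frame_proj f = hpoint (quat2_to_complex4 (f $ 1))"

text \<open>\<open>\<phi> $ b $ a\<close> is \<open>\<phi>\<^sup>b\<^sub>a\<close> evaluated on the vector \<open>X\<close> tangent to \<open>frames\<close> at \<open>f\<close>:
  \<open>de\<^sub>a(X) = X $ a = \<Sum>\<^sub>b e\<^sub>b \<phi>\<^sup>b\<^sub>a(X)\<close>.\<close>

definition connection_form :: "quat^2^2 \<Rightarrow> quat^2^2 \<Rightarrow> quat^2^2" where
  "connection_form f X = (THE \<phi>. \<forall>a. X $ a = (\<Sum>b\<in>UNIV. f $ b \<star>\<^sub>v \<phi> $ b $ a))"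

text \<open>Read off from \<open>\<phi>\<^sup>1\<^sub>1 = i \<rho>\<^sub>1 + j (cnj \<omega>\<^sub>3)\<close> and \<open>\<phi>\<^sup>2\<^sub>1 = \<omega>\<^sub>1 / sqrt 2 + j \<omega>\<^sub>2 / sqrt 2\<close>. The
  corresponding expression for \<open>\<phi>\<^sup>1\<^sub>2\<close> follows from \<open>\<phi>\<^sup>1\<^sub>2 = - qcnj \<phi>\<^sup>2\<^sub>1\<close>.\<close>

definition omega :: "3 \<Rightarrow> quat^2^2 \<Rightarrow> quat^2^2 \<Rightarrow> complex" where
  "omega i f X =
     (let \<phi> = connection_form f X
      in vector [of_real (sqrt 2) * fst (\<phi> $ 2 $ 1),
                 of_real (sqrt 2) * snd (\<phi> $ 2 $ 1),
                 cnj (snd (\<phi> $ 1 $ 1))] $ i)"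

text \<open>The three tensors on \<open>frames\<close>. Wedge products follow the determinant convention
  \<open>(\<alpha> \<and> \<beta>)(X, Y) = \<alpha>(X) \<beta>(Y) - \<alpha>(Y) \<beta>(X)\<close>, and \<open>\<circ>\<close> is the symmetric product, so that
  \<open>(\<omega> \<circ> cnj \<omega>)(X, Y) = Re (\<omega>(X) cnj (\<omega>(Y)))\<close>. The value of the first one is real.\<close>

definition Omega_frames :: "quat^2^2 \<Rightarrow> (quat^2^2)^2 \<Rightarrow> real" where
  "Omega_frames f X =
     Re (\<i> / 2 * (\<Sum>i\<in>UNIV. omega i f (X $ 1) * cnj (omega i f (X $ 2))
                          - omega i f (X $ 2) * cnj (omega i f (X $ 1))))"

definition Psi_frames :: "quat^2^2 \<Rightarrow> (quat^2^2)^3 \<Rightarrow> complex" where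
  "Psi_frames f X = det (\<chi> i k. omega i f (X $ k))"

definition metric_frames :: "quat^2^2 \<Rightarrow> (quat^2^2)^2 \<Rightarrow> real" where
  "metric_frames f X = (\<Sum>i\<in>UNIV. Re (omega i f (X $ 1) * cnj (omega i f (X $ 2))))"

text \<open>The tensor on \<open>CP3\<close> whose pullback under \<open>frame_proj\<close> is \<open>\<beta>\<close>: its value on vectors \<open>u\<^sub>i\<close>
  tangent to \<open>CP3\<close> at \<open>p\<close> is the common value of \<open>\<beta>\<close> on all lifts of the \<open>u\<^sub>i\<close> to frames over \<open>p\<close>.\<close>

definition descend ::
  "(quat^2^2 \<Rightarrow> (quat^2^2)^'k \<Rightarrow> 'b) \<Rightarrow> complex^4^4 \<Rightarrow> (complex^4^4)^'k \<Rightarrow> 'b" where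
  "descend \<beta> p u =
     (THE c. \<forall>f\<in>frames. \<forall>X. frame_proj f = p \<and>
        (\<forall>i. X $ i \<in> tangent_space frames f \<and>
             frechet_derivative frame_proj (at f) (X $ i) = u $ i) \<longrightarrow> \<beta> f X = c)"

definition nearly_kaehler_CP3 :: "(complex^4^4) su3_structure" where
  "nearly_kaehler_CP3 =
     \<lparr>space_of = CP3,
      Omega_of = descend Omega_frames,
      Psi_of = descend Psi_frames,
      metric_of = (\<lambda>p u v. descend metric_frames p (vector [u, v]))\<rparr>"

end

theory Submission
  imports Defs
begin

text \<open>A real unit vector \<open>x\<close> of \<open>\<real>\<^sup>4\<close> lifts to the frame \<open>e\<^sub>1 = x\<close>, \<open>e\<^sub>2 = y\<close>, where \<open>x\<close>, \<open>x j\<close>, \<open>y\<close>, \<open>y j\<close>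
  is an orthonormal basis of \<open>\<real>\<^sup>4 = (\<real> + j \<real>)\<^sup>2\<close>. In this frame a tangent vector \<open>a\<^sub>1 x j + a\<^sub>2 y + a\<^sub>3 y j\<close> of
  \<open>S\<^sup>3\<close> has the real values \<open>(\<omega>\<^sub>1, \<omega>\<^sub>2, \<omega>\<^sub>3) = (sqrt 2 a\<^sub>2, sqrt 2 a\<^sub>3, a\<^sub>1)\<close>, so on the real projective
  space \<open>\<Psi>\<close> is the real volume form \<open>\<omega>\<^sub>1 \<and> \<omega>\<^sub>2 \<and> \<omega>\<^sub>3\<close> of the metric \<open>\<Sum>\<^sub>i \<omega>\<^sub>i\<^sup>2\<close>. Any other frame over
  the same point changes \<open>\<omega>\<close> by a special unitary matrix. The vectors \<open>x j\<close>, \<open>y\<close>, \<open>y j\<close> trivialize the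
  tangent bundle and orient it.\<close>

section \<open>Calculus\<close>

text \<open>On an open set, \<open>frechet_derivative\<close> at a point depends only on nearby
  values, so agreement on \<open>S\<close> passes to derivatives of every order.\<close>

lemma Ck_on_cong:
  assumes "open S" "\<And>x. x \<in> S \<Longrightarrow> f x = g x" "Ck_on n S f"
  shows "Ck_on n S g"
  using assms(2,3)
proof (induction n arbitrary: f g)
  case 0
  then show ?case by (simp cong: continuous_on_cong)
next
  case (Suc n)
  have D: "(g has_derivative frechet_derivative f (at x)) (at x)" if "x \<in> S" for x
    using Suc.prems that assms(1)
    by (metis Ck_on.simps(2) frechet_derivative_works has_derivative_transform_within_open)
  then have "frechet_derivative f (at x) v = frechet_derivative g (at x) v" if "x \<in> S" for x v
    using that by (metis frechet_derivative_at)
  then show ?case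
    using D Suc.prems Suc.IH[of "\<lambda>x. frechet_derivative f (at x) v"
        "\<lambda>x. frechet_derivative g (at x) v" for v]
    by (auto simp: differentiable_def)
qed

text \<open>Lets the inductions below work with an explicit derivative formula, valid on
  \<open>S\<close> only, in place of \<open>frechet_derivative\<close>.\<close>

lemma Ck_on_SucI:
  assumes "open S" "\<And>x. x \<in> S \<Longrightarrow> (f has_derivative f' x) (at x)" "\<And>v. Ck_on n S (\<lambda>x. f' x v)"
  shows "Ck_on (Suc n) S f"
proof -
  have "f' x v = frechet_derivative f (at x) v" if "x \<in> S" for x v
    using frechet_derivative_at[OF assms(2)[OF that]] by simp
  then have "Ck_on n S (\<lambda>x. frechet_derivative f (at x) v)" for v
    by (intro Ck_on_cong[OF assms(1) _ assms(3)[of v]])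
  then show ?thesis
    using assms(2) unfolding Ck_on.simps differentiable_def by blast
qed

lemma Ck_on_SucD:
  assumes "Ck_on (Suc n) S f" "x \<in> S"
  shows "(f has_derivative frechet_derivative f (at x)) (at x)"
  using assms frechet_derivative_works by auto

lemma Ck_on_Suc_imp_Ck_on: "Ck_on (Suc n) S f \<Longrightarrow> Ck_on n S f"
proof (induction n arbitrary: f)
  case 0
  then show ?case
    by (simp add: differentiable_at_withinI differentiable_imp_continuous_on differentiable_on_def)
qed auto

lemma Ck_on_const: "open S \<Longrightarrow> Ck_on n S (\<lambda>x. c)"
proof (induction n arbitrary: c)
  case (Suc n)
  then show ?case by (intro Ck_on_SucI[OF _ has_derivative_const])
qed simp

lemma Ck_on_bounded_linear:
  assumes "open S" "bounded_linear f"
  shows "Ck_on n S f"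
proof (cases n)
  case 0
  then show ?thesis using assms by (simp add: linear_continuous_on)
next
  case (Suc m)
  then show ?thesis
    unfolding Suc using assms
    by (intro Ck_on_SucI[where f' = "\<lambda>_. f"] Ck_on_const bounded_linear_imp_has_derivative)
qed

lemma Ck_on_add:
  assumes "open S" "Ck_on n S f" "Ck_on n S g"
  shows "Ck_on n S (\<lambda>x. f x + g x)"
  using assms(2,3)
proof (induction n arbitrary: f g)
  case (Suc n)
  then show ?case
    by (intro Ck_on_SucI[OF assms(1) has_derivative_add[OF Ck_on_SucD[OF Suc.prems(1)] Ck_on_SucD[OF Suc.prems(2)]]]) auto
qed (auto intro: continuous_intros)

text \<open>The product rule writes the derivative as two values of \<open>B\<close>, each with one
  factor differentiated; hence the induction generalizes over both functions.\<close>

lemma Ck_on_bilinear: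
  assumes "bounded_bilinear B" "open S" "Ck_on n S f" "Ck_on n S g"
  shows "Ck_on n S (\<lambda>x. B (f x) (g x))"
  using assms(3,4)
proof (induction n arbitrary: f g)
  case 0
  then show ?case by (auto intro: bounded_bilinear.continuous_on[OF assms(1)])
next
  case (Suc n)
  show ?case
  proof (rule Ck_on_SucI[OF assms(2) bounded_bilinear.FDERIV[OF assms(1) Ck_on_SucD[OF Suc.prems(1)] Ck_on_SucD[OF Suc.prems(2)]]])
    show "Ck_on n S (\<lambda>x. B (f x) (frechet_derivative g (at x) v) + B (frechet_derivative f (at x) v) (g x))"
      for v
      using Suc.prems Suc.prems[THEN Ck_on_Suc_imp_Ck_on] by (intro Ck_on_add assms(2) Suc.IH) auto
  qed
qed

lemma Ck_on_inverse:
  fixes f :: "'a::real_normed_vector \<Rightarrow> real"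
  assumes "open S" "Ck_on n S f" "\<And>x. x \<in> S \<Longrightarrow> f x \<noteq> 0"
  shows "Ck_on n S (\<lambda>x. inverse (f x))"
  using assms(2)
proof (induction n)
  case 0
  then show ?case using assms by (auto intro: continuous_on_inverse)
next
  case (Suc n)
  show ?case
  proof (rule Ck_on_SucI[OF assms(1)])
    fix x assume "x \<in> S"
    then show "((\<lambda>x. inverse (f x)) has_derivative
        (\<lambda>v. (-1) * (inverse (f x) * frechet_derivative f (at x) v * inverse (f x)))) (at x)"
      using Deriv.has_derivative_inverse[OF assms(3) Ck_on_SucD[OF Suc.prems]] by simp
  next
    show "Ck_on n S (\<lambda>x. (-1) * (inverse (f x) * frechet_derivative f (at x) v * inverse (f x)))" for v
      using Suc.prems Suc.IH[OF Suc.prems[THEN Ck_on_Suc_imp_Ck_on]]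
      by (intro Ck_on_bilinear[OF bounded_bilinear_mult assms(1)] Ck_on_const assms(1)) auto
  qed
qed

section \<open>The real projective space and its tangent spaces\<close>

lemma vector_4 [simp]:
  "(vector [a, b, c, d] :: 'a::zero^4) $ 1 = a"
  "(vector [a, b, c, d] :: 'a::zero^4) $ 2 = b"
  "(vector [a, b, c, d] :: 'a::zero^4) $ 3 = c"
  "(vector [a, b, c, d] :: 'a::zero^4) $ 4 = d"
  by (simp_all add: vector_def)

definition outer :: "real^4 \<Rightarrow> real^4 \<Rightarrow> complex^4^4" where
  "outer x y = (\<chi> i k. of_real (x $ i * y $ k))"

definition cvec :: "real^4 \<Rightarrow> complex^4" where
  "cvec x = (\<chi> i. of_real (x $ i))"

text \<open>The product \<open>a x\<close> with \<open>x\<close> read as \<open>x\<^sub>1 + x\<^sub>2 i + x\<^sub>3 j + x\<^sub>4 k\<close> and \<open>a\<close> as \<open>a\<^sub>1 i + a\<^sub>2 j + a\<^sub>3 k\<close>.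
  This identification of \<open>\<real>\<^sup>4\<close> with the quaternions is unrelated to that of \<open>\<complex>\<^sup>4\<close> with \<open>quat^2\<close>;
  in the latter the three unit moves of \<open>x\<close> are \<open>x j\<close>, \<open>y\<close> and \<open>y j\<close>.\<close>

definition qmove :: "real^4 \<Rightarrow> real^3 \<Rightarrow> real^4" where
  "qmove x a = vector [- a$1 * x$2 - a$2 * x$3 - a$3 * x$4,
                         a$1 * x$1 + a$2 * x$4 - a$3 * x$3,
                       - a$1 * x$4 + a$2 * x$1 + a$3 * x$2,
                         a$1 * x$3 - a$2 * x$2 + a$3 * x$1]"

text \<open>Coordinates with respect to an orthogonal frame of the complement of \<open>x\<close>;
  for a unit \<open>x\<close> a left inverse of \<open>qmove x\<close>.\<close>

definition qcoef :: "real^4 \<Rightarrow> real^4 \<Rightarrow> real^3" where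
  "qcoef x w = (\<chi> k. qmove x (axis k 1) \<bullet> w)"

text \<open>The derivative of \<open>outer x x\<close> when \<open>x\<close> moves with velocity
  \<open>qmove x a\<close>. As this velocity is orthogonal to \<open>x\<close>, the normalizing
  factor in \<open>hpoint\<close> adds nothing at a unit \<open>x\<close>.\<close>

definition rp_tangent :: "real^4 \<Rightarrow> real^3 \<Rightarrow> complex^4^4" where
  "rp_tangent x a = outer x (qmove x a) + outer (qmove x a) x"

lemma inner_4: "x \<bullet> y = x$1 * y$1 + x$2 * y$2 + x$3 * y$3 + x$4 * y$4" for x y :: "real^4"
  by (simp add: inner_vec_def sum_4)

lemma inner_3: "x \<bullet> y = x$1 * y$1 + x$2 * y$2 + x$3 * y$3" for x y :: "real^3"
  by (simp add: inner_vec_def sum_3)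

lemma inner_qmove [simp]: "x \<bullet> qmove x a = 0"
  by (simp add: inner_4 qmove_def algebra_simps)

lemma inner_qmove_qmove: "qmove x a \<bullet> qmove x b = (x \<bullet> x) * (a \<bullet> b)"
  by (simp add: inner_4 inner_3 qmove_def algebra_simps)

lemma qcoef_qmove: "qcoef x (qmove x a) = (x \<bullet> x) *\<^sub>R a"
  by (simp add: qcoef_def inner_qmove_qmove inner_axis' vec_eq_iff)

lemma qcoef_self [simp]: "qcoef x x = 0"
  by (simp add: qcoef_def vec_eq_iff inner_commute)

text \<open>The vector \<open>x\<close> and its three unit moves are pairwise orthogonal and of
  equal length; this is the orthogonal expansion of \<open>w\<close>, with the denominator
  cleared.\<close>

lemma qmove_qcoef: "(x \<bullet> x) *\<^sub>R w = (x \<bullet> w) *\<^sub>R x + qmove x (qcoef x w)"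
  by (simp add: vec_eq_iff forall_4 inner_4 qmove_def qcoef_def axis_def algebra_simps)

lemma bounded_linear_qmove: "bounded_linear (qmove x)"
  by (rule linear_conv_bounded_linear[THEN iffD1], rule linearI)
    (simp_all add: qmove_def vec_eq_iff forall_4 algebra_simps)

lemma bounded_linear_qcoef: "bounded_linear (qcoef x)"
  unfolding qcoef_def
  by (rule linear_conv_bounded_linear[THEN iffD1], rule linearI)
    (simp_all add: vec_eq_iff algebra_simps)

lemma bounded_bilinear_outer: "bounded_bilinear outer"
  unfolding bilinear_conv_bounded_bilinear[symmetric] bilinear_def
  by (auto intro!: linearI simp: outer_def vec_eq_iff algebra_simps scaleR_conv_of_real[where 'a = complex])

lemma norm_cvec [simp]: "norm (cvec x) = norm x"
  by (simp add: cvec_def norm_vec_def)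

lemma cvec_eq_0_iff [simp]: "cvec x = 0 \<longleftrightarrow> x = 0"
  by (simp add: cvec_def vec_eq_iff)

definition couter :: "complex^4 \<Rightarrow> complex^4 \<Rightarrow> complex^4^4" where
  "couter z w = (\<chi> i k. z $ i * cnj (w $ k))"

lemma bounded_bilinear_couter: "bounded_bilinear couter"
  unfolding bilinear_conv_bounded_bilinear[symmetric] bilinear_def
  by (auto intro!: linearI simp: couter_def vec_eq_iff algebra_simps)

lemma couter_cvec: "couter (cvec x) (cvec y) = outer x y"
  by (simp add: couter_def cvec_def outer_def)

lemma hpoint_couter: "hpoint z = inverse (z \<bullet> z) *\<^sub>R couter z z"
  by (simp add: hpoint_def couter_def vec_eq_iff power2_norm_eq_inner[symmetric]
      scaleR_conv_of_real[where 'a = complex] divide_inverse mult_ac)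

lemma inner_cvec: "cvec x \<bullet> cvec y = x \<bullet> y"
  by (simp add: cvec_def inner_vec_def inner_complex_def)

lemma hpoint_cvec: "hpoint (cvec x) = inverse (x \<bullet> x) *\<^sub>R outer x x"
  by (simp add: hpoint_couter couter_cvec inner_cvec)

lemma hpoint_scale: "c \<noteq> 0 \<Longrightarrow> z \<noteq> 0 \<Longrightarrow> hpoint (c *s z) = hpoint z"
  by (subst hpoint_eq_iff) auto

lemma cvec_scaleR: "cvec (c *\<^sub>R x) = of_real c *s cvec x"
  by (simp add: cvec_def vec_eq_iff)

lemma RP3_eq: "RP3 = {hpoint (cvec x) | x. x \<noteq> 0}"
  by (simp add: RP3_def cvec_def)

lemma RP3_unitE:
  assumes "p \<in> RP3"
  obtains x where "x \<bullet> x = 1" "p = outer x x" "p = hpoint (cvec x)"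
proof -
  obtain y where y: "y \<noteq> 0" "p = hpoint (cvec y)" using assms by (auto simp: RP3_eq)
  define x where "x = inverse (norm y) *\<^sub>R y"
  have x: "x \<bullet> x = 1" using y(1) by (simp add: x_def dot_square_norm power2_eq_square field_simps)
  have "p = hpoint (cvec x)"
    using y by (simp add: x_def cvec_scaleR hpoint_scale del: of_real_inverse)
  with x show ?thesis using that[of x] by (simp add: hpoint_cvec)
qed

lemma RP3_subset_CP3: "RP3 \<subseteq> CP3"
  by (auto simp: RP3_eq CP3_def)

definition rapply :: "complex^4^4 \<Rightarrow> real^4 \<Rightarrow> real^4" where
  "rapply p y = (\<chi> i. \<Sum>k\<in>UNIV. Re (p $ i $ k) * y $ k)"

lemma bounded_linear_rapply: "bounded_linear (\<lambda>p. rapply p y)"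
  by (rule linear_conv_bounded_linear[THEN iffD1], rule linearI)
    (simp_all add: rapply_def vec_eq_iff sum_4 algebra_simps)

lemma rapply_add: "rapply (p + q) y = rapply p y + rapply q y"
  and rapply_scaleR: "rapply (c *\<^sub>R p) y = c *\<^sub>R rapply p y"
  by (simp_all add: rapply_def vec_eq_iff sum_4 algebra_simps)

lemma rapply_outer: "rapply (outer x w) y = (w \<bullet> y) *\<^sub>R x"
  by (simp add: rapply_def outer_def vec_eq_iff inner_4 sum_4 algebra_simps)

lemma bounded_linear_rp_tangent: "bounded_linear (rp_tangent x)"
  unfolding rp_tangent_def
  by (intro bounded_linear_add
      bounded_linear_compose[OF bounded_bilinear.bounded_linear_right[OF bounded_bilinear_outer] bounded_linear_qmove]
      bounded_linear_compose[OF bounded_bilinear.bounded_linear_left[OF bounded_bilinear_outer] bounded_linear_qmove])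

lemma rapply_rp_tangent:
  assumes "x \<bullet> x = 1"
  shows "rapply (rp_tangent x a) x = qmove x a"
  using assms by (simp add: rp_tangent_def rapply_add rapply_outer inner_commute[of "qmove x a"])

lemma inj_rp_tangent: "x \<bullet> x = 1 \<Longrightarrow> inj (rp_tangent x)"
  by (rule injI) (metis qcoef_qmove rapply_rp_tangent scaleR_one)

section \<open>Affine charts and their inverses\<close>

definition rp_chart :: "real^4 \<Rightarrow> real^3 \<Rightarrow> complex^4^4" where
  "rp_chart x y = hpoint (cvec (x + qmove x y))"

text \<open>The chart projects the hyperplane of vectors with inner product 1 with \<open>x\<close>
  centrally. To invert it, note that the matrix of a line sends \<open>x\<close> to a vector on that
  line; dividing by its \<open>x\<close>-component removes the scale. The formula makes sense for
  all matrices, not only on \<open>RP3\<close>.\<close>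

definition rp_coord :: "real^4 \<Rightarrow> complex^4^4 \<Rightarrow> real^3" where
  "rp_coord x p = inverse (x \<bullet> rapply p x) *\<^sub>R qcoef x (rapply p x)"

context
  fixes x :: "real^4"
  assumes x: "x \<bullet> x = 1"
begin

lemma inner_chart [simp]: "x \<bullet> (x + qmove x y) = 1"
  by (simp add: inner_right_distrib x)

lemma chart_nonzero [simp]: "x + qmove x y \<noteq> 0"
  using inner_chart[of y] by (metis inner_zero_right zero_neq_one)

lemma rapply_hpoint: "rapply (hpoint (cvec z)) x = ((z \<bullet> x) / (z \<bullet> z)) *\<^sub>R z"
  by (simp add: hpoint_cvec rapply_scaleR rapply_outer divide_inverse_commute)

lemma rp_coord_hpoint: "rp_coord x (hpoint (cvec z)) = qcoef x z /\<^sub>R (x \<bullet> z)"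
proof -
  have "linear (qcoef x)" by (simp add: bounded_linear_qcoef bounded_linear.linear)
  then show ?thesis
    by (cases "z = 0") (auto simp: rp_coord_def rapply_hpoint linear_cmul linear_0 inner_commute field_simps)
qed

lemma rp_coord_chart [simp]: "rp_coord x (rp_chart x y) = y"
  using linear_add[OF bounded_linear.linear[OF bounded_linear_qcoef], of x x "qmove x y"]
  by (simp add: rp_chart_def rp_coord_hpoint qcoef_qmove x)

lemma smooth_on_rp_chart: "smooth_on UNIV (rp_chart x)"
  unfolding smooth_on_def
proof
  fix n
  have z: "Ck_on n UNIV (\<lambda>y. x + qmove x y)"
    by (intro Ck_on_add Ck_on_const Ck_on_bounded_linear bounded_linear_qmove) auto
  show "Ck_on n UNIV (rp_chart x)"
    unfolding rp_chart_def hpoint_cvec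
    by (intro Ck_on_bilinear[OF bounded_bilinear_scaleR] Ck_on_bilinear[OF bounded_bilinear_outer]
        Ck_on_bilinear[OF bounded_bilinear_inner] Ck_on_inverse z) auto
qed

lemma rp_coord_differentiable:
  assumes "x \<bullet> rapply p x \<noteq> 0"
  shows "rp_coord x differentiable (at p)"
  unfolding rp_coord_def
  by (intro differentiable_scaleR differentiable_inverse assms bounded_linear_imp_differentiable
      bounded_linear_compose[OF bounded_linear_inner_right] bounded_linear_compose[OF bounded_linear_qcoef]
      bounded_linear_rapply)

lemma rapply_chart_nonzero: "x \<bullet> rapply (rp_chart x y) x \<noteq> 0"
  by (simp add: rp_chart_def rapply_hpoint inner_commute[of "x + _" x])

lemma range_rp_chart: "range (rp_chart x) = RP3 \<inter> {p. x \<bullet> rapply p x \<noteq> 0}"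
proof (intro subset_antisym subsetI)
  fix p assume "p \<in> range (rp_chart x)"
  then show "p \<in> RP3 \<inter> {p. x \<bullet> rapply p x \<noteq> 0}"
    using rapply_chart_nonzero chart_nonzero by (auto simp: RP3_eq rp_chart_def simp del: chart_nonzero)
next
  fix p assume "p \<in> RP3 \<inter> {p. x \<bullet> rapply p x \<noteq> 0}"
  then obtain z where z: "p = hpoint (cvec z)" "x \<bullet> rapply p x \<noteq> 0" by (auto simp: RP3_eq)
  then have nz: "x \<bullet> z \<noteq> 0" by (auto simp: rapply_hpoint inner_commute)
  \<comment> \<open>Rescaling \<open>z\<close> to have inner product 1 with \<open>x\<close> puts it
    on the hyperplane of the chart.\<close>
  define y where "y = qcoef x z /\<^sub>R (x \<bullet> z)"
  have "z = (x \<bullet> z) *\<^sub>R (x + qmove x y)"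
    using qmove_qcoef[of x z] nz x bounded_linear_qmove[of x, THEN bounded_linear.linear]
    by (simp add: y_def linear_cmul scaleR_right_distrib)
  then have "p = rp_chart x y"
    using nz by (metis chart_nonzero cvec_eq_0_iff cvec_scaleR hpoint_scale of_real_eq_0_iff rp_chart_def z(1))
  then show "p \<in> range (rp_chart x)" by simp
qed

text \<open>The left inverse \<open>rp_coord x\<close> is differentiable on an open set of ambient
  matrices containing the image. By the chain rule the derivative of the chart is injective, and
  continuity of the left inverse gives the homeomorphism.\<close>

lemma local_parametrization_rp_chart: "local_parametrization (rp_chart x) UNIV RP3"
  unfolding local_parametrization_def
proof (intro conjI ballI exI)
  have D: "(rp_chart x has_derivative frechet_derivative (rp_chart x) (at y)) (at y)" for y
    using smooth_on_rp_chart Ck_on_SucD[of 0] unfolding smooth_on_def by blast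
  show "inj (frechet_derivative (rp_chart x) (at y))" for y
  proof -
    obtain \<theta>' where \<theta>': "(rp_coord x has_derivative \<theta>') (at (rp_chart x y))"
      using rp_coord_differentiable[OF rapply_chart_nonzero] by (auto simp: differentiable_def)
    have "((\<lambda>y. y) has_derivative (\<lambda>h. \<theta>' (frechet_derivative (rp_chart x) (at y) h))) (at y)"
      using has_derivative_compose[OF D \<theta>'] by simp
    then have "\<theta>' (frechet_derivative (rp_chart x) (at y) h) = h" for h
      using has_derivative_unique[OF has_derivative_ident] by metis
    then show ?thesis by (metis injI)
  qed
  have "open {p. x \<bullet> rapply p x \<noteq> 0}"
    by (intro open_Collect_neq continuous_on_const linear_continuous_on
        bounded_linear_compose[OF bounded_linear_inner_right] bounded_linear_rapply)
  then show "openin (top_of_set RP3) (range (rp_chart x))"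
    unfolding range_rp_chart by (auto simp: openin_open)
  show "homeomorphism UNIV (range (rp_chart x)) (rp_chart x) (rp_coord x)"
  proof (rule homeomorphismI)
    show "continuous_on UNIV (rp_chart x)"
      using smooth_on_rp_chart Ck_on.simps(1) unfolding smooth_on_def by blast
    show "continuous_on (range (rp_chart x)) (rp_coord x)"
      using rp_coord_differentiable[OF rapply_chart_nonzero]
      by (auto intro!: continuous_at_imp_continuous_on differentiable_imp_continuous_within)
  qed auto
qed (auto simp: smooth_on_rp_chart)

end

lemma smooth_submanifold_RP3: "smooth_submanifold TYPE(3) RP3"
  unfolding smooth_submanifold_def
proof
  fix p assume "p \<in> RP3"
  then obtain x where x: "x \<bullet> x = 1" "p = hpoint (cvec x)" by (rule RP3_unitE)
  have "p = rp_chart x 0"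
    using linear_0[OF bounded_linear.linear[OF bounded_linear_qmove[of x]]] by (simp add: rp_chart_def x)
  then show "\<exists>\<psi> W. local_parametrization (\<psi> :: real^3 \<Rightarrow> _) W RP3 \<and> p \<in> \<psi> ` W"
    using local_parametrization_rp_chart[OF x(1)] by blast
qed

section \<open>Tangent vectors of the real projective space\<close>

lemma rp_tangent_in_tangent_space:
  assumes x: "x \<bullet> x = 1"
  shows "rp_tangent x a \<in> tangent_space RP3 (hpoint (cvec x))"
proof -
  define \<gamma> where "\<gamma> t = hpoint (cvec (x + qmove x (t *\<^sub>R a)))" for t
  have \<gamma>: "\<gamma> t = inverse ((x + t *\<^sub>R qmove x a) \<bullet> (x + t *\<^sub>R qmove x a)) *\<^sub>R
      outer (x + t *\<^sub>R qmove x a) (x + t *\<^sub>R qmove x a)" for t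
    using linear_cmul[OF bounded_linear.linear[OF bounded_linear_qmove[of x]]]
    by (simp add: \<gamma>_def hpoint_cvec)
  have z: "((\<lambda>t. x + t *\<^sub>R qmove x a) has_derivative (\<lambda>h. h *\<^sub>R qmove x a)) (at 0)"
    by (auto intro!: derivative_eq_intros)
  have "(\<gamma> has_vector_derivative rp_tangent x a) (at 0)"
    unfolding \<gamma> has_vector_derivative_def
    by (rule derivative_eq_intros bounded_bilinear.FDERIV[OF bounded_bilinear_outer] z
        | simp add: x)+
      (simp add: x fun_eq_iff rp_tangent_def inner_commute scaleR_right_distrib
        bounded_bilinear.scaleR_left[OF bounded_bilinear_outer]
        bounded_bilinear.scaleR_right[OF bounded_bilinear_outer])
  moreover have "range \<gamma> \<subseteq> RP3"
    using chart_nonzero[OF x] by (auto simp: \<gamma>_def RP3_eq)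
  moreover have "\<gamma> 0 = hpoint (cvec x)" by (simp add: \<gamma> hpoint_cvec)
  ultimately show ?thesis unfolding tangent_space_def by blast
qed

text \<open>Points of \<open>RP3\<close> are real symmetric idempotent matrices. Differentiating
  these equations along a curve shows that its velocity V is real, symmetric and satisfies V = V P +
  P V with P = x x^T. For w = V x this reads V = w x^T + x w^T, and applying it to x shows that w is
  orthogonal to x.\<close>

lemma tangent_space_RP3_subset:
  assumes x: "x \<bullet> x = 1" and v: "v \<in> tangent_space RP3 (hpoint (cvec x))"
  shows "v = rp_tangent x (qcoef x (rapply v x))"
proof -
  from v obtain \<gamma> where \<gamma>: "range \<gamma> \<subseteq> RP3" "\<gamma> 0 = hpoint (cvec x)" "(\<gamma> has_vector_derivative v) (at 0)"
    by (auto simp: tangent_space_def)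
  define r where "r i k t = Re (\<gamma> t $ i $ k)" for i k t
  have entries: "Im (\<gamma> t $ i $ k) = 0 \<and> r i k t = r k i t \<and> (\<Sum>j\<in>UNIV. r i j t * r j k t) = r i k t" for t i k
  proof -
    obtain y where y: "y \<bullet> y = 1" "\<gamma> t = outer y y"
      using \<gamma>(1) by (meson RP3_unitE rangeI subsetD)
    have "(\<Sum>j\<in>UNIV. r i j t * r j k t) = (y \<bullet> y) * r i k t"
      by (simp add: r_def y(2) outer_def sum_4 inner_4 algebra_simps)
    then show ?thesis using y by (simp add: r_def outer_def)
  qed
  have blin: "bounded_linear (\<lambda>p. Re (p $ i $ k))" "bounded_linear (\<lambda>p. Im (p $ i $ k))" for i k
    by (intro bounded_linear_compose[OF bounded_linear_Re] bounded_linear_compose[OF bounded_linear_Im]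
        bounded_linear_compose[OF bounded_linear_vec_nth] bounded_linear_vec_nth)+
  have Dr: "(r i k has_vector_derivative Re (v $ i $ k)) (at 0)" for i k
    unfolding r_def by (rule bounded_linear.has_vector_derivative[OF blin(1) \<gamma>(3)])
  have r0: "r i k 0 = x $ i * x $ k" for i k
    by (simp add: r_def \<gamma>(2) hpoint_cvec x outer_def)
  have Im: "Im (v $ i $ k) = 0" for i k
    using bounded_linear.has_vector_derivative[OF blin(2) \<gamma>(3), of i k]
    by (simp add: entries vector_derivative_unique_at[OF _ has_vector_derivative_const])
  have sym: "Re (v $ i $ k) = Re (v $ k $ i)" for i k
    using Dr[of i k] Dr[of k i] entries by (metis (no_types, lifting) ext vector_derivative_unique_at)
  have idem: "Re (v $ i $ k) = (\<Sum>j\<in>UNIV. Re (v $ i $ j) * (x $ j * x $ k) + (x $ i * x $ j) * Re (v $ j $ k))" for i k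
  proof -
    have "((\<lambda>t. \<Sum>j\<in>UNIV. r i j t * r j k t) has_vector_derivative
        (\<Sum>j\<in>UNIV. r i j 0 * Re (v $ j $ k) + Re (v $ i $ j) * r j k 0)) (at 0)"
      by (intro has_vector_derivative_sum has_vector_derivative_mult Dr)
    moreover have "(\<lambda>t. \<Sum>j\<in>UNIV. r i j t * r j k t) = r i k"
      using entries by (intro ext) blast
    ultimately have "(r i k has_vector_derivative
        (\<Sum>j\<in>UNIV. r i j 0 * Re (v $ j $ k) + Re (v $ i $ j) * r j k 0)) (at 0)"
      by simp
    from vector_derivative_unique_at[OF Dr this] show ?thesis
      by (simp add: r0 add.commute)
  qed
  define w where "w = rapply v x"
  have v_w: "Re (v $ i $ k) = w $ i * x $ k + x $ i * w $ k" for i k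
    by (subst idem) (simp add: w_def rapply_def sum_4 sym[of 1 k] sym[of 2 k] sym[of 3 k] sym[of 4 k] algebra_simps)
  have "w $ i = w $ i + x $ i * (w \<bullet> x)" for i
  proof -
    have "w $ i = (\<Sum>k\<in>UNIV. Re (v $ i $ k) * x $ k)" by (simp add: w_def rapply_def)
    also have "\<dots> = (x \<bullet> x) * w $ i + x $ i * (w \<bullet> x)"
      unfolding v_w by (simp add: sum_4 inner_4 algebra_simps)
    finally show ?thesis using x by simp
  qed
  then have "(w \<bullet> x) *\<^sub>R x = 0" by (cases "w \<bullet> x = 0") (auto simp: vec_eq_iff)
  then have "x \<bullet> w = 0" using x by (auto simp: inner_commute)
  then have w: "w = qmove x (qcoef x w)" using qmove_qcoef[of x w] x by simp
  have "v = outer x w + outer w x"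
    by (simp add: vec_eq_iff complex_eq_iff Im v_w outer_def)
  then show ?thesis
    using w by (simp add: rp_tangent_def w_def)
qed

lemma tangent_space_RP3:
  assumes "x \<bullet> x = 1"
  shows "tangent_space RP3 (hpoint (cvec x)) = range (rp_tangent x)"
  using tangent_space_RP3_subset[OF assms] rp_tangent_in_tangent_space[OF assms] by blast

section \<open>Frames over the real projective space\<close>

lemma qinner_scale_right: "qinner v (w \<star>\<^sub>v q) = qinner v w \<star> q"
  by (simp add: qinner_def qvec_scale_def qmult_relations(4-10))

lemma qinner_scale_left: "qinner (v \<star>\<^sub>v q) w = qcnj q \<star> qinner v w"
  by (simp add: qinner_def qvec_scale_def qmult_relations(4-10))

lemma qinner_add_right: "qinner v (w + w') = qinner v w + qinner v w'"
  by (simp add: qinner_def qmult_relations(4-10))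

lemma qcnj_qinner: "qcnj (qinner v w) = qinner w v"
  by (simp add: qinner_def qmult_def qcnj_def algebra_simps)

lemma qmult_0_left [simp]: "0 \<star> q = 0"
  by (simp add: qmult_def prod_eq_iff)

lemma frames_qinner:
  assumes "f \<in> frames"
  shows "qinner (f $ 1) (f $ 1) = (1, 0)" "qinner (f $ 2) (f $ 2) = (1, 0)"
    "qinner (f $ 1) (f $ 2) = 0" "qinner (f $ 2) (f $ 1) = 0"
  using assms qcnj_qinner[of "f $ 1" "f $ 2"] by (simp_all add: frames_def qcnj_def prod_eq_iff)

lemma qinner_frame_comb:
  assumes "f \<in> frames"
  shows "qinner (f $ 1) (f $ 1 \<star>\<^sub>v q + f $ 2 \<star>\<^sub>v r) = q" "qinner (f $ 2) (f $ 1 \<star>\<^sub>v q + f $ 2 \<star>\<^sub>v r) = r"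
  by (simp_all add: qinner_add_right qinner_scale_right frames_qinner[OF assms] qmult_relations(4-10))

text \<open>Orthonormality makes \<open>q \<mapsto> \<Sum>\<^sub>b e\<^sub>b q\<^sub>b\<close> injective, hence surjective for dimension reasons.\<close>

lemma frame_expansion:
  assumes "f \<in> frames"
  shows "v = f $ 1 \<star>\<^sub>v qinner (f $ 1) v + f $ 2 \<star>\<^sub>v qinner (f $ 2) v"
proof -
  define G where "G q = f $ 1 \<star>\<^sub>v (q $ 1) + f $ 2 \<star>\<^sub>v (q $ 2)" for q :: "quat^2"
  have "linear G"
    by (rule linearI)
      (simp_all add: G_def qvec_scale_def qmult_def vec_eq_iff prod_eq_iff algebra_simps scaleR_conv_of_real[where 'a = complex])
  moreover have "inj G"
  proof (rule injI)
    fix q r assume "G q = G r"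
    then have "q $ 1 = r $ 1" "q $ 2 = r $ 2"
      unfolding G_def using qinner_frame_comb[OF assms] by metis+
    then show "q = r" by (simp add: vec_eq_iff forall_2)
  qed
  ultimately obtain q where "v = G q"
    using linear_injective_imp_surjective by (metis surjD)
  then show ?thesis using qinner_frame_comb[OF assms] by (simp add: G_def)
qed

text \<open>Pairing the defining equation with a frame vector isolates one coefficient, so the
  solution is unique; \<open>frame_expansion\<close> shows that it exists.\<close>

lemma connection_form_frame:
  assumes "f \<in> frames"
  shows "connection_form f X = (\<chi> b a. qinner (f $ b) (X $ a))"
  unfolding connection_form_def sum_2
proof (rule the_equality)
  show "\<forall>a. X $ a = f $ 1 \<star>\<^sub>v (\<chi> b a. qinner (f $ b) (X $ a)) $ 1 $ a
      + f $ 2 \<star>\<^sub>v (\<chi> b a. qinner (f $ b) (X $ a)) $ 2 $ a"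
    using frame_expansion[OF assms] by simp
next
  fix \<phi> :: "quat^2^2"
  assume "\<forall>a. X $ a = f $ 1 \<star>\<^sub>v \<phi> $ 1 $ a + f $ 2 \<star>\<^sub>v \<phi> $ 2 $ a"
  then have "qinner (f $ b) (X $ a) = \<phi> $ b $ a" for a b
    using qinner_frame_comb[OF assms] exhaust_2[of b] by metis
  then show "\<phi> = (\<chi> b a. qinner (f $ b) (X $ a))" by (simp add: vec_eq_iff)
qed

lemma omega_frame:
  assumes "f \<in> frames"
  shows "omega 1 f X = of_real (sqrt 2) * fst (qinner (f $ 2) (X $ 1))"
    "omega 2 f X = of_real (sqrt 2) * snd (qinner (f $ 2) (X $ 1))"
    "omega 3 f X = cnj (snd (qinner (f $ 1) (X $ 1)))"
  by (simp_all add: omega_def connection_form_frame[OF assms] Let_def)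

section \<open>Complex coordinates and the differential of the frame projection\<close>

lemma quat2_to_complex4_nth [simp]:
  "quat2_to_complex4 v $ 1 = fst (v $ 1)" "quat2_to_complex4 v $ 2 = snd (v $ 1)"
  "quat2_to_complex4 v $ 3 = fst (v $ 2)" "quat2_to_complex4 v $ 4 = snd (v $ 2)"
  by (simp_all add: quat2_to_complex4_def)

lemma bounded_linear_quat2_to_complex4: "bounded_linear quat2_to_complex4"
  by (rule linear_conv_bounded_linear[THEN iffD1], rule linearI) (simp_all add: vec_eq_iff forall_4)

lemma quat2_to_complex4_eq_iff: "quat2_to_complex4 v = quat2_to_complex4 w \<longleftrightarrow> v = w"
  by (auto simp: vec_eq_iff forall_4 forall_2 prod_eq_iff)

lemma quat2_to_complex4_scale: "quat2_to_complex4 (v \<star>\<^sub>v (c, 0)) = c *s quat2_to_complex4 v"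
  by (simp add: vec_eq_iff forall_4 qvec_scale_def qmult_def)

lemma inner_quat2_to_complex4: "quat2_to_complex4 v \<bullet> quat2_to_complex4 w = Re (fst (qinner v w))"
  by (simp add: inner_vec_def sum_4 qinner_def qmult_def qcnj_def inner_complex_def)

definition hprod :: "complex^4 \<Rightarrow> complex^4 \<Rightarrow> complex" where
  "hprod w y = (\<Sum>k\<in>UNIV. cnj (w $ k) * y $ k)"

lemma couter_mult_vec: "couter z w *v y = hprod w y *s z"
  by (simp add: couter_def hprod_def matrix_vector_mult_def vec_eq_iff sum_distrib_left sum_distrib_right mult_ac)

lemma hprod_self: "hprod z z = of_real (z \<bullet> z)"
  by (simp add: hprod_def inner_vec_def complex_eq_iff inner_complex_def)

lemma hprod_cvec: "hprod (cvec x) (cvec y) = of_real (x \<bullet> y)"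
  by (simp add: hprod_def inner_vec_def cvec_def)

lemma hprod_scale: "hprod w (c *s y) = c * hprod w y"
  by (simp add: hprod_def sum_distrib_left mult_ac)

text \<open>The quotient rule for z z^* / |z|^2, where z depends linearly on the frame; the last
  term comes from the denominator.\<close>

lemma frechet_derivative_frame_proj:
  assumes z: "z = quat2_to_complex4 (f $ 1)" "z \<bullet> z = 1" and w: "w = quat2_to_complex4 (X $ 1)"
  shows "frechet_derivative frame_proj (at f) X
    = couter z w + couter w z - (2 * (z \<bullet> w)) *\<^sub>R couter z z"
proof -
  define Z where "Z X = quat2_to_complex4 (X $ 1)" for X :: "quat^2^2"
  have Z: "(Z has_derivative Z) (at f)"
    unfolding Z_def
    by (intro bounded_linear_imp_has_derivative
        bounded_linear_compose[OF bounded_linear_quat2_to_complex4] bounded_linear_vec_nth)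
  have [simp]: "Z f = z" "Z X = w" "z \<bullet> z = 1"
    by (simp_all only: Z_def assms(1,3)[symmetric] assms(2))
  have "frame_proj = (\<lambda>f. inverse (Z f \<bullet> Z f) *\<^sub>R couter (Z f) (Z f))"
    by (simp add: fun_eq_iff frame_proj_def hpoint_couter Z_def)
  moreover have "((\<lambda>f. inverse (Z f \<bullet> Z f) *\<^sub>R couter (Z f) (Z f)) has_derivative
      (\<lambda>X. couter z (Z X) + couter (Z X) z - (2 * (z \<bullet> Z X)) *\<^sub>R couter z z)) (at f)"
  proof (rule has_derivative_eq_rhs)
    show "((\<lambda>f. inverse (Z f \<bullet> Z f) *\<^sub>R couter (Z f) (Z f)) has_derivative
        (\<lambda>X. inverse (Z f \<bullet> Z f) *\<^sub>R (couter (Z f) (Z X) + couter (Z X) (Z f))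
          + (- (inverse (Z f \<bullet> Z f) * (Z f \<bullet> Z X + Z X \<bullet> Z f) * inverse (Z f \<bullet> Z f)))
            *\<^sub>R couter (Z f) (Z f))) (at f)"
      by (intro has_derivative_scaleR Deriv.has_derivative_inverse has_derivative_inner Z
          bounded_bilinear.FDERIV[OF bounded_bilinear_couter]) simp
  qed (simp add: fun_eq_iff inner_commute[of "Z _" z])
  ultimately have "frechet_derivative frame_proj (at f)
      = (\<lambda>X. couter z (Z X) + couter (Z X) z - (2 * (z \<bullet> Z X)) *\<^sub>R couter z z)"
    using frechet_derivative_at[symmetric] by simp
  then show ?thesis by simp
qed

section \<open>Real frames\<close>

definition rlift :: "real^4 \<Rightarrow> quat^2" where
  "rlift x = vector [(of_real (x $ 1), of_real (x $ 2)), (of_real (x $ 3), of_real (x $ 4))]"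

text \<open>For a real unit vector \<open>x\<close> the vector orthogonal to \<open>rlift x\<close> over the quaternions can be chosen real.\<close>

definition frame_lift :: "real^4 \<Rightarrow> quat^2^2" where
  "frame_lift x = vector [rlift x, rlift (qmove x (axis 2 1))]"

lemma quat2_to_complex4_rlift: "quat2_to_complex4 (rlift x) = cvec x"
  by (simp add: rlift_def cvec_def vec_eq_iff forall_4)

text \<open>For a unit \<open>x\<close> the lift of \<open>qmove x a\<close> is x j a_1 + y (a_2 + j
  a_3), where y lifts \<open>qmove x (axis 2 1)\<close>; pairing with x and y reads off the
  coefficients.\<close>

lemma qinner_rlift_qmove:
  "qinner (rlift x) (rlift (qmove x a)) = (0, of_real ((x \<bullet> x) * a $ 1))"
  "qinner (rlift (qmove x (axis 2 1))) (rlift (qmove x a)) = (of_real ((x \<bullet> x) * a $ 2), of_real ((x \<bullet> x) * a $ 3))"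
  by (simp_all add: qinner_def rlift_def qmove_def qmult_def qcnj_def inner_4 axis_def complex_eq_iff algebra_simps)

lemma qinner_rlift_self: "qinner (rlift x) (rlift x) = (of_real (x \<bullet> x), 0)"
  by (simp add: qinner_def rlift_def qmult_def qcnj_def inner_4 complex_eq_iff algebra_simps)

lemma frame_lift_in_frames: "x \<bullet> x = 1 \<Longrightarrow> frame_lift x \<in> frames"
  by (simp add: frames_def frame_lift_def qinner_rlift_qmove qinner_rlift_self inner_qmove_qmove
      inner_3 axis_def prod_eq_iff)

lemma bounded_linear_frame_lift: "bounded_linear frame_lift"
  by (rule linear_conv_bounded_linear[THEN iffD1], rule linearI)
    (simp_all add: frame_lift_def rlift_def qmove_def vec_eq_iff forall_2 algebra_simps
      scaleR_conv_of_real[where 'a = complex])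

text \<open>The straight line \<open>y\<close> leaves the unit sphere and is renormalized by
  \<open>g\<close>. As \<open>w\<close> is orthogonal to \<open>x\<close>, \<open>g\<close> has
  derivative 0 at 0 and the velocity stays \<open>w\<close>; the linear map
  \<open>frame_lift\<close> carries the sphere into \<open>frames\<close>.\<close>

lemma frame_lift_tangent:
  assumes x: "x \<bullet> x = 1"
  shows "frame_lift (qmove x a) \<in> tangent_space frames (frame_lift x)"
proof -
  define w where "w = qmove x a"
  define y where "y t = x + t *\<^sub>R w" for t
  define g where "g t = inverse (sqrt (1 + t\<^sup>2 * (w \<bullet> w)))" for t
  have N: "y t \<bullet> y t = 1 + t\<^sup>2 * (w \<bullet> w)" for t
    using x by (simp add: y_def w_def inner_add_left inner_add_right inner_commute[of "qmove x a" x] power2_eq_square)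
  have pos: "1 + t\<^sup>2 * (w \<bullet> w) > 0" for t by (intro add_pos_nonneg) auto
  have "(g has_vector_derivative 0) (at 0)"
    unfolding g_def has_real_derivative_iff_has_vector_derivative[symmetric]
    by (auto intro!: derivative_eq_intros)
  moreover have "(y has_vector_derivative w) (at 0)"
    unfolding y_def by (auto intro!: derivative_eq_intros)
  ultimately have "((\<lambda>t. g t *\<^sub>R y t) has_vector_derivative w) (at 0)"
    by (auto simp: g_def y_def has_real_derivative_iff_has_vector_derivative intro!: derivative_eq_intros)
  then have "((\<lambda>t. frame_lift (g t *\<^sub>R y t)) has_vector_derivative frame_lift w) (at 0)"
    by (rule bounded_linear.has_vector_derivative[OF bounded_linear_frame_lift])
  moreover have "frame_lift (g t *\<^sub>R y t) \<in> frames" for t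
  proof (rule frame_lift_in_frames)
    define s where "s = sqrt (1 + t\<^sup>2 * (w \<bullet> w))"
    have "s \<noteq> 0" "y t \<bullet> y t = s * s" using pos[of t] by (simp_all add: N s_def)
    then show "(g t *\<^sub>R y t) \<bullet> (g t *\<^sub>R y t) = 1" by (simp add: g_def divide_simps flip: s_def)
  qed
  moreover have "frame_lift (g 0 *\<^sub>R y 0) = frame_lift x" by (simp add: g_def y_def)
  ultimately show ?thesis
    unfolding tangent_space_def w_def[symmetric]
    by (intro CollectI exI[of _ "\<lambda>t. frame_lift (g t *\<^sub>R y t)"]) auto
qed

lemma frame_proj_frame_lift: "frame_proj (frame_lift x) = hpoint (cvec x)"
  by (simp add: frame_proj_def frame_lift_def quat2_to_complex4_rlift)

lemma frame_proj_derivative_frame_lift: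
  assumes "x \<bullet> x = 1"
  shows "frechet_derivative frame_proj (at (frame_lift x)) (frame_lift (qmove x a)) = rp_tangent x a"
  by (subst frechet_derivative_frame_proj[OF refl _ refl])
    (simp_all add: frame_lift_def quat2_to_complex4_rlift inner_cvec assms couter_cvec rp_tangent_def)

text \<open>The frames over a point of the real projective space form an orbit of \<open>U(1) \<times> Sp(1)\<close>:
  \<open>c\<close> and \<open>m + j n\<close> are the parameters of \<open>f\<close> relative to \<open>frame_lift x\<close>.\<close>

lemma omega_over_RP3:
  assumes x: "x \<bullet> x = 1" and f: "f \<in> frames" "frame_proj f = hpoint (cvec x)"
  obtains c m n where "c * cnj c = 1" "m * cnj m + n * cnj n = 1"
    "\<And>X a. frechet_derivative frame_proj (at f) X = rp_tangent x a \<Longrightarrow>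
      omega 1 f X = of_real (sqrt 2) * c * (m * of_real (a $ 2) - cnj n * of_real (a $ 3)) \<and>
      omega 2 f X = of_real (sqrt 2) * c * (n * of_real (a $ 2) + cnj m * of_real (a $ 3)) \<and>
      omega 3 f X = (cnj c)\<^sup>2 * of_real (a $ 1)"
proof -
  define z where "z = quat2_to_complex4 (f $ 1)"
  have z: "z \<bullet> z = 1" by (simp add: z_def inner_quat2_to_complex4 frames_qinner[OF f(1)])
  then have "z \<noteq> 0" "cvec x \<noteq> 0" using x by auto
  with f(2) obtain c where c: "z = c *s cvec x"
    unfolding frame_proj_def z_def[symmetric] using hpoint_eq_iff by metis
  have "cmod c * norm x = norm z"
    by (subst norm_cvec[symmetric]) (simp add: c norm_vec_def norm_mult L2_set_right_distrib)
  then have "cmod c = 1" using x z by (simp add: norm_eq_sqrt_inner)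
  then have cc: "c * cnj c = 1" using complex_norm_square[of c] by simp
  have f1: "f $ 1 = rlift x \<star>\<^sub>v (c, 0)"
    by (simp add: quat2_to_complex4_eq_iff[symmetric] quat2_to_complex4_scale quat2_to_complex4_rlift c[symmetric] z_def)
  then have "rlift x = f $ 1 \<star>\<^sub>v (cnj c, 0)"
    using cc by (simp add: qvec_scale_def qmult_relations(4-10) vec_eq_iff)
  then have f2x: "qinner (f $ 2) (rlift x) = 0"
    by (simp add: qinner_scale_right frames_qinner[OF f(1)])
  define y where "y = rlift (qmove x (axis 2 1))"
  define m n where "m = fst (qinner (f $ 2) y)" and "n = snd (qinner (f $ 2) y)"
  have mn: "qinner (f $ 2) y = (m, n)" by (simp add: m_def n_def)
  have exp: "v = rlift x \<star>\<^sub>v qinner (rlift x) v + y \<star>\<^sub>v qinner y v" for v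
    using frame_expansion[OF frame_lift_in_frames[OF x], of v] by (simp add: frame_lift_def y_def)
  \<comment> \<open>Since \<open>f $ 2\<close> is orthogonal to \<open>rlift x\<close>, only the
    \<open>y\<close> component of \<open>v\<close> survives.\<close>
  have f2: "qinner (f $ 2) v = (m, n) \<star> qinner y v" for v
    by (subst exp) (simp add: qinner_add_right qinner_scale_right f2x mn)
  have "(1, 0) = (m, n) \<star> qcnj (m, n)"
    using f2[of "f $ 2"] by (simp add: qcnj_qinner flip: mn) (simp add: frames_qinner[OF f(1)])
  then have mn1: "m * cnj m + n * cnj n = 1"
    by (simp add: qmult_def qcnj_def mult.commute)
  show ?thesis
  proof (rule that[OF cc mn1])
    fix X a assume X: "frechet_derivative frame_proj (at f) X = rp_tangent x a"
    define w where "w = quat2_to_complex4 (X $ 1)"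
    \<comment> \<open>Applying two expressions for the same tangent vector to \<open>z\<close>
      determines \<open>w\<close> up to the multiple \<open>s\<close> of \<open>z\<close>, the
      direction that the projection forgets.\<close>
    define s where "s = of_real (2 * (z \<bullet> w)) - hprod w z"
    have "rp_tangent x a *v z = (couter z w + couter w z - (2 * (z \<bullet> w)) *\<^sub>R couter z z) *v z"
      using frechet_derivative_frame_proj[OF z_def z w_def] X by simp
    also have "\<dots> = couter z w *v z + couter w z *v z - of_real (2 * (z \<bullet> w)) *s (couter z z *v z)"
      by (simp add: matrix_vector_mult_def vec_eq_iff sum_4 scaleR_conv_of_real[where 'a = complex] algebra_simps)
    also have "\<dots> = w - s *s z"
      by (simp add: couter_mult_vec hprod_self z s_def vec_eq_iff algebra_simps)
    finally have "w = c *s cvec (qmove x a) + s *s z"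
      by (simp add: rp_tangent_def couter_cvec[symmetric] matrix_vector_mult_add_rdistrib couter_mult_vec
          c hprod_scale hprod_cvec inner_commute[of "qmove x a"] x algebra_simps)
    \<comment> \<open>The \<open>s\<close> term enters only the complex part of
      \<open>qinner (f $ 1) (X $ 1)\<close>, which none of the three \<open>omega\<close>
      reads.\<close>
    then have "X $ 1 = rlift (qmove x a) \<star>\<^sub>v (c, 0) + f $ 1 \<star>\<^sub>v (s, 0)"
      using linear_add[OF bounded_linear.linear[OF bounded_linear_quat2_to_complex4]]
      by (simp add: quat2_to_complex4_eq_iff[symmetric] quat2_to_complex4_scale quat2_to_complex4_rlift
          w_def[symmetric] z_def[symmetric])
    then have
      "qinner (f $ 1) (X $ 1) = qcnj (c, 0) \<star> qinner (rlift x) (rlift (qmove x a)) \<star> (c, 0) + (s, 0)"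
      "qinner (f $ 2) (X $ 1) = (m, n) \<star> qinner y (rlift (qmove x a)) \<star> (c, 0)"
      by (simp_all add: qinner_add_right qinner_scale_right frames_qinner[OF f(1)] f2[of "rlift _"]
          qmult_relations(4-10)) (simp add: f1 qinner_scale_left qmult_relations(4-10))
    then show "omega 1 f X = of_real (sqrt 2) * c * (m * of_real (a $ 2) - cnj n * of_real (a $ 3)) \<and>
      omega 2 f X = of_real (sqrt 2) * c * (n * of_real (a $ 2) + cnj m * of_real (a $ 3)) \<and>
      omega 3 f X = (cnj c)\<^sup>2 * of_real (a $ 1)"
      by (simp add: omega_frame[OF f(1)] qinner_rlift_qmove y_def x qmult_def qcnj_def power2_eq_square algebra_simps)
  qed
qed

section \<open>The structure on the real projective space\<close>

text \<open>The given lift makes the value under \<open>THE\<close> unique; the last premise, on all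
  lifts, makes it exist.\<close>

lemma descend_eq:
  assumes "f \<in> frames" "frame_proj f = p"
    and "\<And>i. X $ i \<in> tangent_space frames f"
    and "\<And>i. frechet_derivative frame_proj (at f) (X $ i) = u $ i"
    and "\<And>f X. f \<in> frames \<Longrightarrow> frame_proj f = p \<Longrightarrow>
      (\<And>i. frechet_derivative frame_proj (at f) (X $ i) = u $ i) \<Longrightarrow> \<beta> f X = c"
  shows "descend \<beta> p u = c"
  unfolding descend_def by (rule the_equality) (use assms in blast)+

lemma descend_RP3:
  assumes x: "x \<bullet> x = 1"
    and "\<And>f X. f \<in> frames \<Longrightarrow> frame_proj f = hpoint (cvec x) \<Longrightarrow>
      (\<And>i. frechet_derivative frame_proj (at f) (X $ i) = rp_tangent x (A $ i)) \<Longrightarrow> \<beta> f X = c"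
  shows "descend \<beta> (hpoint (cvec x)) (\<chi> i. rp_tangent x (A $ i)) = c"
  by (rule descend_eq[of "frame_lift x" _ "\<chi> i. frame_lift (qmove x (A $ i))"])
    (simp_all add: assms frame_lift_in_frames frame_proj_frame_lift frame_lift_tangent
      frame_proj_derivative_frame_lift)

lemma of_real_sqrt_2: "complex_of_real (sqrt 2) * complex_of_real (sqrt 2) = 2"
  by (simp flip: of_real_mult)

text \<open>The matrix \<open>M\<close> sends coordinates to values of \<open>omega\<close>. In its
  determinant the phase \<open>c\<close>, occurring twice, cancels against the square of
  \<open>cnj c\<close>, the block in \<open>m\<close> and \<open>n\<close> is special unitary, and
  the two factors \<open>sqrt 2\<close> leave 2, whatever the frame.\<close>

lemma Psi_RP3:
  assumes x: "x \<bullet> x = 1"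
  shows "descend Psi_frames (hpoint (cvec x)) (\<chi> i. rp_tangent x (A $ i)) = of_real (2 * det A)"
proof (rule descend_RP3[OF x])
  fix f X
  assume f: "f \<in> frames" "frame_proj f = hpoint (cvec x)"
    and X: "\<And>i. frechet_derivative frame_proj (at f) (X $ i) = rp_tangent x (A $ i)"
  from omega_over_RP3[OF x f] obtain c m n where cmn: "c * cnj c = 1" "m * cnj m + n * cnj n = 1"
    and om: "\<And>X a. frechet_derivative frame_proj (at f) X = rp_tangent x a \<Longrightarrow>
      omega 1 f X = of_real (sqrt 2) * c * (m * of_real (a $ 2) - cnj n * of_real (a $ 3)) \<and>
      omega 2 f X = of_real (sqrt 2) * c * (n * of_real (a $ 2) + cnj m * of_real (a $ 3)) \<and>
      omega 3 f X = (cnj c)\<^sup>2 * of_real (a $ 1)" by metis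
  define M :: "complex^3^3" where
    "M = vector [vector [0, of_real (sqrt 2) * c * m, - of_real (sqrt 2) * c * cnj n],
                 vector [0, of_real (sqrt 2) * c * n, of_real (sqrt 2) * c * cnj m],
                 vector [(cnj c)\<^sup>2, 0, 0]]"
  \<comment> \<open>A transpose, since tangent vectors index the columns in
    \<open>Psi_frames\<close> but the rows of \<open>A\<close>.\<close>
  define B :: "complex^3^3" where "B = (\<chi> i k. of_real (A $ k $ i))"
  have "Psi_frames f X = det (M ** B)"
    unfolding Psi_frames_def
    by (rule arg_cong[where f = det])
      (simp add: M_def B_def matrix_matrix_mult_def vec_eq_iff forall_3 sum_3 om[OF X] algebra_simps)
  also have "\<dots> = det M * det B" by (rule det_mul)
  also have "det M = (of_real (sqrt 2) * of_real (sqrt 2)) * (c * cnj c)\<^sup>2 * (m * cnj m + n * cnj n)"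
    by (simp add: M_def det_3 power2_eq_square algebra_simps)
  also have "\<dots> = 2" by (simp only: of_real_sqrt_2 cmn) simp
  also have "det B = of_real (det A)" by (simp add: B_def det_3)
  finally show "Psi_frames f X = of_real (2 * det A)" by simp
qed

text \<open>Frame changes act unitarily: the mixed terms of the second and third coordinates cancel
  between \<open>omega 1\<close> and \<open>omega 2\<close>, and the parameters enter only through
  \<open>c * cnj c\<close> and \<open>m * cnj m + n * cnj n\<close>, both 1.\<close>

lemma metric_RP3:
  assumes x: "x \<bullet> x = 1"
  shows "descend metric_frames (hpoint (cvec x)) (vector [rp_tangent x a, rp_tangent x b])
    = a $ 1 * b $ 1 + 2 * a $ 2 * b $ 2 + 2 * a $ 3 * b $ 3"
proof -
  have "(vector [rp_tangent x a, rp_tangent x b] :: (complex^4^4)^2)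
      = (\<chi> i. rp_tangent x ((vector [a, b] :: (real^3)^2) $ i))"
    by (simp add: vec_eq_iff[where 'b = 2] forall_2)
  moreover have "descend metric_frames (hpoint (cvec x)) (\<chi> i. rp_tangent x ((vector [a, b] :: (real^3)^2) $ i))
    = a $ 1 * b $ 1 + 2 * a $ 2 * b $ 2 + 2 * a $ 3 * b $ 3"
  proof (rule descend_RP3[OF x])
    fix f and X :: "(quat^2^2)^2"
    assume f: "f \<in> frames" "frame_proj f = hpoint (cvec x)"
      and X: "\<And>i. frechet_derivative frame_proj (at f) (X $ i) = rp_tangent x ((vector [a, b] :: (real^3)^2) $ i)"
    from omega_over_RP3[OF x f] obtain c m n where cmn: "c * cnj c = 1" "m * cnj m + n * cnj n = 1"
      and om: "\<And>X a. frechet_derivative frame_proj (at f) X = rp_tangent x a \<Longrightarrow>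
        omega 1 f X = of_real (sqrt 2) * c * (m * of_real (a $ 2) - cnj n * of_real (a $ 3)) \<and>
        omega 2 f X = of_real (sqrt 2) * c * (n * of_real (a $ 2) + cnj m * of_real (a $ 3)) \<and>
        omega 3 f X = (cnj c)\<^sup>2 * of_real (a $ 1)" by metis
    have "(\<Sum>i\<in>UNIV. omega i f (X $ 1) * cnj (omega i f (X $ 2)))
        = (of_real (sqrt 2) * of_real (sqrt 2)) * (c * cnj c) * (m * cnj m + n * cnj n)
            * of_real (a $ 2 * b $ 2 + a $ 3 * b $ 3) + (c * cnj c)\<^sup>2 * of_real (a $ 1 * b $ 1)"
      by (simp add: sum_3 om[OF X] power2_eq_square algebra_simps)
    also have "\<dots> = of_real (a $ 1 * b $ 1 + 2 * a $ 2 * b $ 2 + 2 * a $ 3 * b $ 3)"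
      by (simp only: of_real_sqrt_2 cmn) (simp add: algebra_simps)
    finally show "metric_frames f X = a $ 1 * b $ 1 + 2 * a $ 2 * b $ 2 + 2 * a $ 3 * b $ 3"
      unfolding metric_frames_def Re_sum[symmetric] by simp
  qed
  ultimately show ?thesis by simp
qed

text \<open>Matrices of the left multiplications by the imaginary units. As they are skew-symmetric,
  their commutators with \<open>x x\<^sup>T\<close> are the tangent vectors \<open>rp_tangent x (axis k 1)\<close>: a global frame.\<close>

definition qmove_matrix :: "3 \<Rightarrow> complex^4^4" where
  "qmove_matrix k = (\<chi> i j. of_real (qmove (axis j 1) (axis k 1) $ i))"

definition rp_frame :: "complex^4^4 \<Rightarrow> (complex^4^4)^3" where
  "rp_frame p = (\<chi> k. qmove_matrix k ** p - p ** qmove_matrix k)"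

lemma rp_frame_at:
  assumes "x \<bullet> x = 1"
  shows "rp_frame (hpoint (cvec x)) = (\<chi> k. rp_tangent x (axis k 1))"
proof -
  have "qmove_matrix k ** outer x x = outer (qmove x (axis k 1)) x" for k
    using exhaust_3[of k]
    by (auto simp: qmove_matrix_def outer_def matrix_matrix_mult_def vec_eq_iff forall_4 sum_4 qmove_def axis_def algebra_simps)
  moreover have "outer x x ** qmove_matrix k = - outer x (qmove x (axis k 1))" for k
    using exhaust_3[of k]
    by (auto simp: qmove_matrix_def outer_def matrix_matrix_mult_def vec_eq_iff forall_4 sum_4 qmove_def axis_def algebra_simps)
  ultimately show ?thesis
    using assms by (simp add: rp_frame_def rp_tangent_def hpoint_cvec add.commute)
qed

text \<open>The commutator formula is linear in the matrix \<open>p\<close>, so no choice of sign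
  for the unit vector over \<open>p\<close> enters.\<close>

lemma continuous_on_rp_frame: "continuous_on S rp_frame"
  unfolding rp_frame_def matrix_matrix_mult_def
  by (intro continuous_intros)

lemma sum_axis_rp_tangent: "(\<Sum>j\<in>UNIV. a $ j *\<^sub>R rp_tangent x (axis j 1)) = rp_tangent x a"
proof -
  have lin: "linear (rp_tangent x)" by (rule bounded_linear.linear[OF bounded_linear_rp_tangent])
  have "a = (\<Sum>j\<in>UNIV. a $ j *\<^sub>R axis j 1)"
    by (simp add: vec_eq_iff axis_def if_distrib cong: if_cong)
  then have "rp_tangent x a = rp_tangent x (\<Sum>j\<in>UNIV. a $ j *\<^sub>R axis j 1)" by simp
  also have "\<dots> = (\<Sum>j\<in>UNIV. a $ j *\<^sub>R rp_tangent x (axis j 1))"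
    by (simp add: linear_sum[OF lin] linear_cmul[OF lin])
  finally show ?thesis by simp
qed

lemma rp_frame_tangent_frame:
  assumes "p \<in> RP3"
  shows "rp_frame p \<in> tangent_frames RP3 p"
proof -
  obtain x where x: "x \<bullet> x = 1" "p = hpoint (cvec x)" using assms by (rule RP3_unitE)
  have lin: "linear (rp_tangent x)" by (rule bounded_linear.linear[OF bounded_linear_rp_tangent])
  have inj: "inj (rp_tangent x)" by (rule inj_rp_tangent[OF x(1)])
  have "range (\<lambda>k. rp_tangent x (axis k 1)) = rp_tangent x ` Basis"
    by (auto simp: Basis_vec_def)
  moreover have "independent (rp_tangent x ` Basis)"
    by (intro linear_independent_injective_image lin independent_Basis) (use inj in \<open>auto simp: inj_on_def\<close>)
  moreover have "span (rp_tangent x ` Basis) = range (rp_tangent x)"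
    by (simp add: linear_span_image[OF lin])
  moreover have "inj (\<lambda>k::3. rp_tangent x (axis k 1))"
    by (rule injI) (metis inj injD axis_eq_axis zero_neq_one)
  ultimately show ?thesis
    by (simp add: tangent_frames_def x rp_frame_at tangent_space_RP3 vec_lambda_inverse)
qed

section \<open>Orientation and volume form\<close>

definition rp_orientation :: "complex^4^4 \<Rightarrow> ((complex^4^4)^3) set" where
  "rp_orientation p = {b. same_orientation (rp_frame p) b}"

lemma orientation_RP3: "orientation RP3 rp_orientation"
  unfolding orientation_def
proof (intro ballI conjI)
  show "\<exists>b\<in>tangent_frames RP3 p. rp_orientation p = {b'. same_orientation b b'}" if "p \<in> RP3" for p
    using rp_frame_tangent_frame[OF that] by (auto simp: rp_orientation_def)
  have refl: "same_orientation b b" for b :: "(complex^4^4)^3"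
    unfolding same_orientation_def
    by (rule exI[of _ "mat 1"]) (simp, simp add: mat_def if_distrib if_distribR cong: if_cong)
  show "\<exists>U s. openin (top_of_set RP3) U \<and> p \<in> U \<and> continuous_on U s \<and> (\<forall>q\<in>U. s q \<in> rp_orientation q)"
    if "p \<in> RP3" for p
    using that refl continuous_on_rp_frame
    by (intro exI[of _ RP3] exI[of _ rp_frame]) (auto simp: rp_orientation_def)
qed

text \<open>The rows of \<open>A\<close> are coordinates relative to \<open>rp_frame\<close>; by
  injectivity of \<open>rp_tangent x\<close>, \<open>A\<close> is the only possible transition
  matrix in \<open>same_orientation\<close>.\<close>

lemma rp_tangent_in_orientation_iff:
  assumes x: "x \<bullet> x = 1"
  shows "(\<chi> i. rp_tangent x (A $ i)) \<in> rp_orientation (hpoint (cvec x)) \<longleftrightarrow> det A > 0"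
proof -
  have "rp_tangent x a = rp_tangent x b \<longleftrightarrow> a = b" for a b
    using inj_rp_tangent[OF x] by (auto dest: injD)
  then have "(\<forall>i. rp_tangent x (A $ i) = rp_tangent x (A' $ i)) \<longleftrightarrow> A = A'" for A'
    by (simp add: vec_eq_iff)
  then show ?thesis
    by (simp add: rp_orientation_def same_orientation_def rp_frame_at[OF x] sum_axis_rp_tangent)
qed

text \<open>The Gram matrix is A D A^T with det D = 4, so its root is 2 |det A|; the orientation
  sign removes the absolute value.\<close>

lemma volume_form_RP3:
  assumes x: "x \<bullet> x = 1"
  shows "volume_form (\<lambda>p u v. descend metric_frames p (vector [u, v])) rp_orientation (hpoint (cvec x))
      (\<chi> i. rp_tangent x (A $ i)) = 2 * det A"
proof -
  define D :: "real^3^3" where "D = (\<chi> i j. if i = j then (if i = 1 then 1 else 2) else 0)"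
  have "(\<chi> i j. descend metric_frames (hpoint (cvec x)) (vector [rp_tangent x (A $ i), rp_tangent x (A $ j)]))
      = A ** D ** transpose A"
    by (simp add: metric_RP3[OF x] D_def matrix_matrix_mult_def transpose_def vec_eq_iff sum_3)
  moreover have "det (A ** D ** transpose A) = (2 * det A)\<^sup>2"
    by (simp add: det_mul D_def det_3[of "\<chi> i j. _ i j"] power2_eq_square)
  ultimately show ?thesis
    by (simp add: volume_form_def rp_tangent_in_orientation_iff[OF x] real_sqrt_mult)
qed

theorem theorem5p1:
  shows "special_lagrangian nearly_kaehler_CP3 RP3"
  unfolding special_lagrangian_def
proof (intro conjI exI ballI allI impI)
  show "RP3 \<subseteq> space_of nearly_kaehler_CP3"
    by (simp add: nearly_kaehler_CP3_def RP3_subset_CP3)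
  show "smooth_submanifold TYPE(3) RP3" by (rule smooth_submanifold_RP3)
  show "orientation RP3 rp_orientation" by (rule orientation_RP3)
  fix p and v :: "(complex^4^4)^3"
  assume p: "p \<in> RP3" and v: "\<forall>i. v $ i \<in> tangent_space RP3 p"
  obtain x where x: "x \<bullet> x = 1" "p = hpoint (cvec x)" using p by (rule RP3_unitE)
  have "\<forall>i. \<exists>a. v $ i = rp_tangent x a" using v by (auto simp: x tangent_space_RP3)
  then obtain a where "\<And>i. v $ i = rp_tangent x (a i)" by metis
  \<comment> \<open>With the coordinates of the vectors as rows of one matrix, both sides become
    twice its determinant.\<close>
  then have "v = (\<chi> i. rp_tangent x ((\<chi> i. a i) $ i))" by (simp add: vec_eq_iff[where 'b = 3])
  then show "Re (Psi_of nearly_kaehler_CP3 p v) = volume_form (metric_of nearly_kaehler_CP3) rp_orientation p v"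
    by (simp only: nearly_kaehler_CP3_def su3_structure.simps x Psi_RP3[OF x(1)] volume_form_RP3[OF x(1)])
      simp
qed

end
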